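(* Suppose $(S,\to,\twoheadrightarrow,\hookrightarrow)$ is a finite two-acyclic factorization system and $C\subseteq S$ is a $\rightsquigarrow$-upset. Then the restriction of $(S,\to,\twoheadrightarrow,\hookrightarrow)$ to $C$ is a two-acyclic factorization system and the map $(X,Y)\mapsto(X\cap C,Y\cap C)$ is a surjective lattice homomorphism between the corresponding lattices of maximal orthogonal pairs (from $\operatorname{Pairs}(\to)$ to $\operatorname{Pairs}(\to|_C)$). Every lattice quotient of $\operatorname{Pairs}(\to)$ arises in this way for a unique $\rightsquigarrow$-upset $C$.
   Context: For a binary relation $\to$ on a set $S$ and $X\subseteq S$, put $X^\perp=\{y\in S: x\not\to y\ \forall x\in X\}$ and ${}^\perp X=\{y\in S: y\not\to x\ \forall x\in X\}$. A maximal orthogonal pair is a pair $(X,Y)$ of subsets of $S$ with $Y=X^\perp$ and $X={}^\perp Y$. $\operatorname{Pairs}(\to)$ is the complete lattice of maximal orthogonal pairs, partially ordered by containment of first components (equivalently reverse containment of second components). For a reflexive relation $\to$ on $S$, $\operatorname{Fact}(\to)=(\twoheadrightarrow,\hookrightarrow)$, where $x\twoheadrightarrow y$ iff for all $z$, $y\to z$ implies $x\to z$, and $x\hookrightarrow y$ iff for all $z$, $z\to x$ implies $z\to y$. For preorders $\twoheadrightarrow,\hookrightarrow$ on $S$, $\operatorname{Mult}(\twoheadrightarrow,\hookrightarrow)$ is the relation relating $x$ to $z$ iff there is $y\in S$ with $x\twoheadrightarrow y\hookrightarrow z$. A factorization system is a tuple $(S,\to,\twoheadrightarrow,\hookrightarrow)$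 with $\to$ a reflexive relation on $S$, $\operatorname{Fact}(\to)=(\twoheadrightarrow,\hookrightarrow)$ and $\operatorname{Mult}(\twoheadrightarrow,\hookrightarrow)=\to$. It is finite if $S$ is finite. It is two-acyclic if it satisfies the order condition ($x\twoheadrightarrow y\twoheadrightarrow x$ implies $x=y$, and $x\hookrightarrow y\hookrightarrow x$ implies $x=y$) and the brick condition ($x\twoheadrightarrow y\hookrightarrow x$ implies $x=y$). Its restriction to $C\subseteq S$ is the tuple obtained by restricting all three relations to $C$. Convention: $x\twoheadrightarrow y$ or $x\hookrightarrow y$ is read as "$x$ is greater than or equal to $y$" in the corresponding partial order; thus $x$ is $\twoheadrightarrow$-minimal in a set $A\ni x$ if there is no $x'\in A\setminus\{x\}$ with $x\twoheadrightarrow x'$, and $x$ is $\hookrightarrow$-maximal in $A$ if there is no $x'\in A\setminus\{x\}$ with $x'\hookrightarrow x$. For $y\in S$, $T(y)=\{x'\in S: y\twoheadrightarrow x'\}$ and $F(y)=\{x'\in S: x'\hookrightarrow y\}$. The relation $\rightsquigarrow$ on $S$: $x\rightsquigarrow y$ iff either $x$ is $\twoheadrightarrow$-minimal in $F(y)$ or $x$ is $\hookrightarrow$-maximal in $T(y)$. A $\rightsquigarrow$-upset is a subset $C\subseteq S$ such that $x\rightsquigarrow y$ and $y\in C$ imply $x\in C$. A lattice quotient of a lattice $L$ is $L/\Theta$ for a lattice congruence $\Theta$ (an equivalence relation compatible with binary meets and joins); it arises from a surjective lattice homomorphism when the congruence classes of $\Theta$ are the fibers of that homomorphism. *)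

theory Defs
  imports "HOL-Algebra.Complete_Lattice"
begin

definition right_orth :: "'a set \<Rightarrow> 'a rel \<Rightarrow> 'a set \<Rightarrow> 'a set" where
  "right_orth S arr X = {y \<in> S. \<forall>x\<in>X. (x, y) \<notin> arr}"

definition left_orth :: "'a set \<Rightarrow> 'a rel \<Rightarrow> 'a set \<Rightarrow> 'a set" where
  "left_orth S arr X = {y \<in> S. \<forall>x\<in>X. (y, x) \<notin> arr}"

definition max_orth_pairs :: "'a set \<Rightarrow> 'a rel \<Rightarrow> ('a set \<times> 'a set) set" where
  "max_orth_pairs S arr =
    {(X, Y). X \<subseteq> S \<and> Y \<subseteq> S \<and> Y = right_orth S arr X \<and> X = left_orth S arr Y}"

definition Pairs :: "'a set \<Rightarrow> 'a rel \<Rightarrow> ('a set \<times> 'a set) gorder" where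
  "Pairs S arr =
    \<lparr>carrier = max_orth_pairs S arr, eq = (=), le = (\<lambda>p q. fst p \<subseteq> fst q)\<rparr>"

definition Fact :: "'a set \<Rightarrow> 'a rel \<Rightarrow> 'a rel \<times> 'a rel" where
  "Fact S arr =
    ({(x, y). x \<in> S \<and> y \<in> S \<and> (\<forall>z\<in>S. (y, z) \<in> arr \<longrightarrow> (x, z) \<in> arr)},
     {(x, y). x \<in> S \<and> y \<in> S \<and> (\<forall>z\<in>S. (z, x) \<in> arr \<longrightarrow> (z, y) \<in> arr)})"

definition Mult :: "'a set \<Rightarrow> 'a rel \<Rightarrow> 'a rel \<Rightarrow> 'a rel" where
  "Mult S onto into =
    {(x, z). x \<in> S \<and> z \<in> S \<and> (\<exists>y\<in>S. (x, y) \<in> onto \<and> (y, z) \<in> into)}"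

definition factorization_system :: "'a set \<Rightarrow> 'a rel \<Rightarrow> 'a rel \<Rightarrow> 'a rel \<Rightarrow> bool" where
  "factorization_system S arr onto into \<longleftrightarrow>
    arr \<subseteq> S \<times> S \<and> refl_on S arr \<and> Fact S arr = (onto, into) \<and> Mult S onto into = arr"

definition order_condition :: "'a set \<Rightarrow> 'a rel \<Rightarrow> 'a rel \<Rightarrow> bool" where
  "order_condition S onto into \<longleftrightarrow>
    (\<forall>x\<in>S. \<forall>y\<in>S. (x, y) \<in> onto \<and> (y, x) \<in> onto \<longrightarrow> x = y) \<and>
    (\<forall>x\<in>S. \<forall>y\<in>S. (x, y) \<in> into \<and> (y, x) \<in> into \<longrightarrow> x = y)"

definition brick_condition :: "'a set \<Rightarrow> 'a rel \<Rightarrow> 'a rel \<Rightarrow> bool" where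
  "brick_condition S onto into \<longleftrightarrow>
    (\<forall>x\<in>S. \<forall>y\<in>S. (x, y) \<in> onto \<and> (y, x) \<in> into \<longrightarrow> x = y)"

definition two_acyclic_factorization_system ::
    "'a set \<Rightarrow> 'a rel \<Rightarrow> 'a rel \<Rightarrow> 'a rel \<Rightarrow> bool" where
  "two_acyclic_factorization_system S arr onto into \<longleftrightarrow>
    factorization_system S arr onto into \<and>
    order_condition S onto into \<and> brick_condition S onto into"

text \<open>A pair \<open>(x, y)\<close> in \<open>onto\<close> or \<open>into\<close> is read as: \<open>x\<close> is greater than or equal to \<open>y\<close>.\<close>

definition minimal_in :: "'a rel \<Rightarrow> 'a set \<Rightarrow> 'a \<Rightarrow> bool" where
  "minimal_in ge A x \<longleftrightarrow> x \<in> A \<and> \<not> (\<exists>x'\<in>A - {x}. (x, x') \<in> ge)"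

definition maximal_in :: "'a rel \<Rightarrow> 'a set \<Rightarrow> 'a \<Rightarrow> bool" where
  "maximal_in ge A x \<longleftrightarrow> x \<in> A \<and> \<not> (\<exists>x'\<in>A - {x}. (x', x) \<in> ge)"

definition T_set :: "'a set \<Rightarrow> 'a rel \<Rightarrow> 'a \<Rightarrow> 'a set" where
  "T_set S onto y = {x' \<in> S. (y, x') \<in> onto}"

definition F_set :: "'a set \<Rightarrow> 'a rel \<Rightarrow> 'a \<Rightarrow> 'a set" where
  "F_set S into y = {x' \<in> S. (x', y) \<in> into}"

definition squig :: "'a set \<Rightarrow> 'a rel \<Rightarrow> 'a rel \<Rightarrow> 'a rel" where
  "squig S onto into =
    {(x, y). x \<in> S \<and> y \<in> S \<and>
      (minimal_in onto (F_set S into y) x \<or> maximal_in into (T_set S onto y) x)}"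

definition squig_upset :: "'a set \<Rightarrow> 'a rel \<Rightarrow> 'a rel \<Rightarrow> 'a set \<Rightarrow> bool" where
  "squig_upset S onto into C \<longleftrightarrow>
    C \<subseteq> S \<and> (\<forall>x y. (x, y) \<in> squig S onto into \<and> y \<in> C \<longrightarrow> x \<in> C)"

text \<open>\<open>join_pres\<close> and \<open>meet_pres\<close> include that both \<open>L\<close> and \<open>M\<close> are lattices.\<close>

definition lattice_hom ::
    "('a, 'c) gorder_scheme \<Rightarrow> ('b, 'd) gorder_scheme \<Rightarrow> ('a \<Rightarrow> 'b) \<Rightarrow> bool" where
  "lattice_hom L M f \<longleftrightarrow>
    f \<in> carrier L \<rightarrow> carrier M \<and> join_pres L M f \<and> meet_pres L M f"

definition surj_lattice_hom ::
    "('a, 'c) gorder_scheme \<Rightarrow> ('b, 'd) gorder_scheme \<Rightarrow> ('a \<Rightarrow> 'b) \<Rightarrow> bool" where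
  "surj_lattice_hom L M f \<longleftrightarrow> lattice_hom L M f \<and> f ` carrier L = carrier M"

definition lattice_congruence :: "('a, 'c) gorder_scheme \<Rightarrow> 'a rel \<Rightarrow> bool" where
  "lattice_congruence L \<Theta> \<longleftrightarrow>
    equiv (carrier L) \<Theta> \<and>
    (\<forall>x x' y y'. (x, x') \<in> \<Theta> \<and> (y, y') \<in> \<Theta> \<longrightarrow>
      (x \<sqinter>\<^bsub>L\<^esub> y, x' \<sqinter>\<^bsub>L\<^esub> y') \<in> \<Theta> \<and> (x \<squnion>\<^bsub>L\<^esub> y, x' \<squnion>\<^bsub>L\<^esub> y') \<in> \<Theta>)"

text \<open>The \<open>\<Theta>\<close>-classes are exactly the fibers of the surjective homomorphism \<open>f\<close>, so \<open>L / \<Theta>\<close> is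
identified with \<open>M\<close> via \<open>f\<close>.\<close>

definition quotient_arises_from ::
    "('a, 'c) gorder_scheme \<Rightarrow> 'a rel \<Rightarrow> ('b, 'd) gorder_scheme \<Rightarrow> ('a \<Rightarrow> 'b) \<Rightarrow> bool" where
  "quotient_arises_from L \<Theta> M f \<longleftrightarrow>
    surj_lattice_hom L M f \<and>
    carrier L // \<Theta> = (\<lambda>q. {p \<in> carrier L. f p = q}) ` carrier M"

definition restrict_pair :: "'a set \<Rightarrow> 'a set \<times> 'a set \<Rightarrow> 'a set \<times> 'a set" where
  "restrict_pair C = (\<lambda>(X, Y). (X \<inter> C, Y \<inter> C))"

end

theory Submission
  imports Defs
begin

text \<open>
  Write \<open>j(x)\<close> and \<open>m(x)\<close> for the maximal orthogonal pairs with first component \<open>T(x)\<close> and second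
  component \<open>F(x)\<close>, respectively.

  If \<open>x \<rightarrow> z\<close>, then an \<open>onto\<close>-minimal choice of the middle object of a factorization satisfies
  \<open>y \<leadsto> z\<close>, and an \<open>into\<close>-maximal choice satisfies \<open>y \<leadsto> x\<close>.  Hence an arrow with one end in an upset
  \<open>C\<close> factors through \<open>C\<close>; this makes restriction to \<open>C\<close> compatible with all the structure.

  For the converse, the brick condition gives that \<open>j(x) \<sqinter> m(x)\<close> has first component \<open>T(x) - {x}\<close> and
  \<open>j(x) \<squnion> m(x)\<close> has second component \<open>F(x) - {x}\<close>, so these are the unique lower cover of \<open>j(x)\<close> and
  the unique upper cover of \<open>m(x)\<close>, and a congruence contracts one of these two edges iff it contracts
  the other.  The upset belonging to a congruence consists of the \<open>x\<close> whose edge is not contracted.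
\<close>

section \<open>The lattice of maximal orthogonal pairs\<close>

lemma carrier_Pairs [simp]: "carrier (Pairs S arr) = max_orth_pairs S arr"
  and le_Pairs [simp]: "le (Pairs S arr) p q \<longleftrightarrow> fst p \<subseteq> fst q"
  and eq_Pairs [simp]: "eq (Pairs S arr) = (=)"
  by (simp_all add: Pairs_def)

lemma max_orth_pairs_iff:
  "p \<in> max_orth_pairs S arr \<longleftrightarrow> snd p = right_orth S arr (fst p) \<and> fst p = left_orth S arr (snd p)"
  by (auto simp: max_orth_pairs_def right_orth_def left_orth_def)

lemma max_orth_pairs_subset:
  assumes "p \<in> max_orth_pairs S arr"
  shows "fst p \<subseteq> S" "snd p \<subseteq> S"
  using assms by (auto simp: max_orth_pairs_def)

lemma mem_fst_iff:
  "p \<in> max_orth_pairs S arr \<Longrightarrow> x \<in> fst p \<longleftrightarrow> x \<in> S \<and> (\<forall>y\<in>snd p. (x, y) \<notin> arr)"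
  and mem_snd_iff:
  "p \<in> max_orth_pairs S arr \<Longrightarrow> y \<in> snd p \<longleftrightarrow> y \<in> S \<and> (\<forall>x\<in>fst p. (x, y) \<notin> arr)"
  by (auto simp: max_orth_pairs_def right_orth_def left_orth_def)

lemma fst_subset_iff:
  assumes "p \<in> max_orth_pairs S arr" "q \<in> max_orth_pairs S arr"
  shows "fst p \<subseteq> fst q \<longleftrightarrow> snd q \<subseteq> snd p"
  using assms unfolding max_orth_pairs_iff right_orth_def left_orth_def by blast

lemma max_orth_pairs_eqI:
  assumes "p \<in> max_orth_pairs S arr" "q \<in> max_orth_pairs S arr"
    and "fst p = fst q \<or> snd p = snd q"
  shows "p = q"
  using assms by (metis max_orth_pairs_iff prod_eq_iff)

text \<open>The two orthogonality operators form an antitone Galois connection on subsets of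
  \<open>S\<close>, so one of them applied after a round trip gives back its first value.\<close>

lemma right_orth_closure_mem:
  assumes "Y \<subseteq> S"
  shows "(left_orth S arr Y, right_orth S arr (left_orth S arr Y)) \<in> max_orth_pairs S arr"
  using assms by (auto simp: max_orth_pairs_def right_orth_def left_orth_def)

lemma left_orth_closure_mem:
  assumes "X \<subseteq> S"
  shows "(left_orth S arr (right_orth S arr X), right_orth S arr X) \<in> max_orth_pairs S arr"
  using assms by (auto simp: max_orth_pairs_def right_orth_def left_orth_def)

lemma partial_order_Pairs: "partial_order (Pairs S arr)"
proof (unfold_locales, goal_cases)
  \<comment> \<open>Antisymmetry: the order sees first components only, and these determine the
    pair.\<close>
  case (5 x y)
  then show ?case by (simp; blast intro: max_orth_pairs_eqI[of x S arr y])
qed simp_all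

section \<open>Meets and joins of maximal orthogonal pairs\<close>

lemma mem_Lower_Pairs_iff:
  assumes "p \<in> max_orth_pairs S arr" "q \<in> max_orth_pairs S arr"
  shows "r \<in> Lower (Pairs S arr) {p, q} \<longleftrightarrow>
    r \<in> max_orth_pairs S arr \<and> fst r \<subseteq> fst p \<and> fst r \<subseteq> fst q"
  using assms by (simp add: Lower_def del: split_paired_All) blast

lemma mem_Upper_Pairs_iff:
  assumes "p \<in> max_orth_pairs S arr" "q \<in> max_orth_pairs S arr"
  shows "r \<in> Upper (Pairs S arr) {p, q} \<longleftrightarrow>
    r \<in> max_orth_pairs S arr \<and> fst p \<subseteq> fst r \<and> fst q \<subseteq> fst r"
  using assms by (simp add: Upper_def del: split_paired_All) blast

text \<open>The left orthogonal of a union of second components is the intersection of the first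
  components, so that intersection is again a first component.\<close>

lemma Pairs_meet_exists:
  assumes "p \<in> max_orth_pairs S arr" "q \<in> max_orth_pairs S arr"
  shows "\<exists>s. greatest (Pairs S arr) s (Lower (Pairs S arr) {p, q}) \<and> fst s = fst p \<inter> fst q"
proof -
  let ?Y = "snd p \<union> snd q"
  let ?s = "(left_orth S arr ?Y, right_orth S arr (left_orth S arr ?Y))"
  have s: "?s \<in> max_orth_pairs S arr"
    using assms by (intro right_orth_closure_mem) (auto dest: max_orth_pairs_subset)
  have fst: "fst ?s = fst p \<inter> fst q"
    using mem_fst_iff[OF assms(1)] mem_fst_iff[OF assms(2)] by (auto simp: left_orth_def)
  have "greatest (Pairs S arr) ?s (Lower (Pairs S arr) {p, q})"
    using assms s fst by (intro greatest_LowerI) (auto simp: mem_Lower_Pairs_iff)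
  with fst show ?thesis by blast
qed

lemma Pairs_join_exists:
  assumes "p \<in> max_orth_pairs S arr" "q \<in> max_orth_pairs S arr"
  shows "\<exists>s. least (Pairs S arr) s (Upper (Pairs S arr) {p, q}) \<and> snd s = snd p \<inter> snd q"
proof -
  let ?X = "fst p \<union> fst q"
  let ?s = "(left_orth S arr (right_orth S arr ?X), right_orth S arr ?X)"
  have s: "?s \<in> max_orth_pairs S arr"
    using assms by (intro left_orth_closure_mem) (auto dest: max_orth_pairs_subset)
  have snd: "snd ?s = snd p \<inter> snd q"
    using mem_snd_iff[OF assms(1)] mem_snd_iff[OF assms(2)] by (auto simp: right_orth_def)
  have "least (Pairs S arr) ?s (Upper (Pairs S arr) {p, q})"
  proof (rule least_UpperI)
    fix r assume r: "r \<in> {p, q}"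
    \<comment> \<open>The order is defined by first components, so bounds are proved on second
      components and transported by \<open>fst_subset_iff\<close>.\<close>
    then have "snd ?s \<subseteq> snd r" using snd by auto
    then show "r \<sqsubseteq>\<^bsub>Pairs S arr\<^esub> ?s"
      using fst_subset_iff[OF _ s, of r] r assms by auto
  next
    fix r assume "r \<in> Upper (Pairs S arr) {p, q}"
    then have r: "r \<in> max_orth_pairs S arr" "fst p \<subseteq> fst r" "fst q \<subseteq> fst r"
      using assms by (simp_all add: mem_Upper_Pairs_iff)
    then have "snd r \<subseteq> snd ?s"
      using assms fst_subset_iff snd by blast
    then show "?s \<sqsubseteq>\<^bsub>Pairs S arr\<^esub> r"
      using fst_subset_iff[OF s r(1)] by simp
  qed (use assms s in auto)
  with snd show ?thesis by blast
qed

lemma lattice_Pairs: "lattice (Pairs S arr)"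
proof -
  interpret partial_order "Pairs S arr" by (rule partial_order_Pairs)
  show ?thesis
    by unfold_locales (metis carrier_Pairs Pairs_meet_exists Pairs_join_exists)+
qed

lemma
  assumes "p \<in> max_orth_pairs S arr" "q \<in> max_orth_pairs S arr"
  shows meet_Pairs_mem: "p \<sqinter>\<^bsub>Pairs S arr\<^esub> q \<in> max_orth_pairs S arr"
    and join_Pairs_mem: "p \<squnion>\<^bsub>Pairs S arr\<^esub> q \<in> max_orth_pairs S arr"
    and fst_meet_Pairs: "fst (p \<sqinter>\<^bsub>Pairs S arr\<^esub> q) = fst p \<inter> fst q"
    and snd_join_Pairs: "snd (p \<squnion>\<^bsub>Pairs S arr\<^esub> q) = snd p \<inter> snd q"
proof -
  interpret lattice "Pairs S arr" by (rule lattice_Pairs)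
  show "p \<sqinter>\<^bsub>Pairs S arr\<^esub> q \<in> max_orth_pairs S arr" "p \<squnion>\<^bsub>Pairs S arr\<^esub> q \<in> max_orth_pairs S arr"
    using meet_closed join_closed assms by simp_all
  obtain s where s: "greatest (Pairs S arr) s (Lower (Pairs S arr) {p, q})" "fst s = fst p \<inter> fst q"
    using Pairs_meet_exists[OF assms] by blast
  then have "p \<sqinter>\<^bsub>Pairs S arr\<^esub> q = s"
    using greatest_unique assms unfolding meet_def inf_def by blast
  with s show "fst (p \<sqinter>\<^bsub>Pairs S arr\<^esub> q) = fst p \<inter> fst q" by simp
  obtain s where s: "least (Pairs S arr) s (Upper (Pairs S arr) {p, q})" "snd s = snd p \<inter> snd q"
    using Pairs_join_exists[OF assms] by blast
  then have "p \<squnion>\<^bsub>Pairs S arr\<^esub> q = s"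
    using least_unique assms unfolding join_def sup_def by blast
  with s show "snd (p \<squnion>\<^bsub>Pairs S arr\<^esub> q) = snd p \<inter> snd q" by simp
qed

lemma
  assumes "p \<in> max_orth_pairs S arr" "q \<in> max_orth_pairs S arr" "fst p \<subseteq> fst q"
  shows meet_Pairs_absorb1: "p \<sqinter>\<^bsub>Pairs S arr\<^esub> q = p"
    and join_Pairs_absorb1: "p \<squnion>\<^bsub>Pairs S arr\<^esub> q = q"
    and join_Pairs_absorb2: "q \<squnion>\<^bsub>Pairs S arr\<^esub> p = q"
  using assms fst_subset_iff[OF assms(1,2)]
  by (auto intro!: max_orth_pairs_eqI[of _ S arr] meet_Pairs_mem join_Pairs_mem
      simp: fst_meet_Pairs snd_join_Pairs)

text \<open>Two elements are related exactly when some class contains both, so the partition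
  recovers the relation. This later turns an equality between classes and fibers into a statement
  about pairs of elements.\<close>

lemma quotient_inject:
  assumes "equiv A r" "equiv A s" "A // r = A // s"
  shows "r = s"
proof -
  have "(x, y) \<in> t \<longleftrightarrow> (\<exists>X\<in>A // t. x \<in> X \<and> y \<in> X)" if t: "equiv A t" for x y t
  proof
    assume "(x, y) \<in> t"
    then show "\<exists>X\<in>A // t. x \<in> X \<and> y \<in> X"
      using equiv_type[OF t] equiv_class_self[OF t] by (intro bexI[of _ "t `` {x}"]) (auto intro: quotientI)
  qed (use in_quotient_imp_in_rel[OF t] in blast)
  from this[OF assms(1)] this[OF assms(2)] show ?thesis
    using assms(3) by auto
qed

section \<open>Two-acyclic factorization systems\<close>

lemma ex_minimal_in:
  assumes "finite A" "x \<in> A" "(x, x) \<in> ge" "trans ge" "antisym ge"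
  obtains m where "minimal_in ge A m" "(x, m) \<in> ge"
proof -
  \<comment> \<open>Searching only below \<open>x\<close> puts the minimal element below
    \<open>x\<close>; by transitivity it is still minimal in all of \<open>A\<close>.\<close>
  define B where "B = {a \<in> A. (x, a) \<in> ge}"
  have "\<exists>m\<in>B. \<forall>a\<in>B. a \<noteq> m \<longrightarrow> \<not> ((m, a) \<in> ge \<and> a \<noteq> m)"
  proof (rule Finite_Set.bex_min_element)
    show "transp_on B (\<lambda>a m. (m, a) \<in> ge \<and> a \<noteq> m)"
      using assms(4,5) by (auto intro!: transp_onI dest: transD antisymD)
    show "asymp_on B (\<lambda>a m. (m, a) \<in> ge \<and> a \<noteq> m)"
      using assms(5) by (auto intro!: asymp_onI dest: antisymD)
  qed (use assms in \<open>auto simp: B_def\<close>)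
  then show thesis
    using that assms(4) by (fastforce simp: B_def minimal_in_def dest: transD)
qed

lemma maximal_in_iff_minimal_in_converse: "maximal_in ge A x \<longleftrightarrow> minimal_in (ge\<inverse>) A x"
  by (simp add: maximal_in_def minimal_in_def)

locale two_acyclic =
  fixes S :: "'a set" and arr onto into :: "'a rel"
  assumes finite_S: "finite S"
    and two_acyclic: "two_acyclic_factorization_system S arr onto into"
begin

lemma arr_subset: "(x, y) \<in> arr \<Longrightarrow> x \<in> S \<and> y \<in> S"
  and arr_refl: "x \<in> S \<Longrightarrow> (x, x) \<in> arr"
  using two_acyclic
  by (auto simp: two_acyclic_factorization_system_def factorization_system_def refl_on_def)

lemma onto_iff: "(x, y) \<in> onto \<longleftrightarrow> x \<in> S \<and> y \<in> S \<and> (\<forall>z. (y, z) \<in> arr \<longrightarrow> (x, z) \<in> arr)"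
  and into_iff: "(x, y) \<in> into \<longleftrightarrow> x \<in> S \<and> y \<in> S \<and> (\<forall>z. (z, x) \<in> arr \<longrightarrow> (z, y) \<in> arr)"
  using two_acyclic arr_subset
  by (auto simp: two_acyclic_factorization_system_def factorization_system_def Fact_def)

lemma arr_iff: "(x, z) \<in> arr \<longleftrightarrow> (\<exists>y. (x, y) \<in> onto \<and> (y, z) \<in> into)"
proof -
  have "Mult S onto into = arr"
    using two_acyclic by (simp add: two_acyclic_factorization_system_def factorization_system_def)
  then show ?thesis
    using onto_iff into_iff unfolding Mult_def by blast
qed

lemma onto_refl: "x \<in> S \<Longrightarrow> (x, x) \<in> onto"
  and into_refl: "x \<in> S \<Longrightarrow> (x, x) \<in> into"
  and onto_trans: "(x, y) \<in> onto \<Longrightarrow> (y, z) \<in> onto \<Longrightarrow> (x, z) \<in> onto"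
  and into_trans: "(x, y) \<in> into \<Longrightarrow> (y, z) \<in> into \<Longrightarrow> (x, z) \<in> into"
  by (auto simp: onto_iff into_iff)

lemma onto_antisym: "(x, y) \<in> onto \<Longrightarrow> (y, x) \<in> onto \<Longrightarrow> x = y"
  and into_antisym: "(x, y) \<in> into \<Longrightarrow> (y, x) \<in> into \<Longrightarrow> x = y"
  and brick: "(x, y) \<in> onto \<Longrightarrow> (y, x) \<in> into \<Longrightarrow> x = y"
  using two_acyclic onto_iff into_iff
  unfolding two_acyclic_factorization_system_def order_condition_def brick_condition_def by blast+

subsection \<open>Restriction to an upset\<close>

lemma factor_through_upset_target:
  assumes C: "squig_upset S onto into C" and xz: "(x, z) \<in> arr" and "z \<in> C"
  obtains y where "y \<in> C" "(x, y) \<in> onto" "(y, z) \<in> into"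
proof -
  obtain w where w: "(x, w) \<in> onto" "(w, z) \<in> into" using xz arr_iff by blast
  then have "finite (F_set S into z)" "w \<in> F_set S into z"
    using finite_S by (auto simp: F_set_def into_iff)
  \<comment> \<open>Replacing \<open>w\<close> by an \<open>onto\<close>-smaller element of
    \<open>F(z)\<close> keeps both factors: \<open>x\<close> reaches \<open>y\<close> through
    \<open>w\<close>, and membership in \<open>F(z)\<close> provides the second factor.\<close>
  then obtain y where y: "minimal_in onto (F_set S into z) y" "(w, y) \<in> onto"
    by (rule ex_minimal_in[of _ w onto])
      (use w onto_iff in \<open>auto intro: transI antisymI onto_refl onto_trans onto_antisym\<close>)
  then have "(y, z) \<in> squig S onto into" "(y, z) \<in> into"
    using w into_iff by (auto simp: squig_def minimal_in_def F_set_def)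
  with C \<open>z \<in> C\<close> have "y \<in> C" unfolding squig_upset_def by blast
  then show thesis using that w y onto_trans \<open>(y, z) \<in> into\<close> by blast
qed

lemma factor_through_upset_source:
  assumes C: "squig_upset S onto into C" and xz: "(x, z) \<in> arr" and "x \<in> C"
  obtains y where "y \<in> C" "(x, y) \<in> onto" "(y, z) \<in> into"
proof -
  obtain w where w: "(x, w) \<in> onto" "(w, z) \<in> into" using xz arr_iff by blast
  then have "finite (T_set S onto x)" "w \<in> T_set S onto x"
    using finite_S by (auto simp: T_set_def onto_iff)
  \<comment> \<open>Dually, \<open>w\<close> moves up along \<open>into\<close> inside
    \<open>T(x)\<close>; passing to the converse relation turns maximal into minimal.\<close>
  then obtain y where "minimal_in (into\<inverse>) (T_set S onto x) y" "(w, y) \<in> into\<inverse>"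
    by (rule ex_minimal_in[of _ w "into\<inverse>"])
      (use w into_iff in \<open>auto intro!: transI antisymI intro: into_refl into_trans into_antisym\<close>)
  then have y: "maximal_in into (T_set S onto x) y" "(y, w) \<in> into"
    by (simp_all add: maximal_in_iff_minimal_in_converse)
  then have "(y, x) \<in> squig S onto into" "(x, y) \<in> onto"
    using w onto_iff by (auto simp: squig_def maximal_in_def T_set_def)
  with C \<open>x \<in> C\<close> have "y \<in> C" unfolding squig_upset_def by blast
  then show thesis using that w y into_trans \<open>(x, y) \<in> onto\<close> by blast
qed

text \<open>The content is that \<open>Fact\<close> and \<open>Mult\<close> commute with
  restriction. For \<open>Fact\<close>, a test against objects of \<open>C\<close> must imply the
  test against all of \<open>S\<close>: an arrow between an object of \<open>C\<close> and an
  arbitrary \<open>z\<close> passes through some \<open>w\<close> in \<open>C\<close>, and the test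
  at \<open>w\<close> carries over to \<open>z\<close>. For \<open>Mult\<close>, the middle object
  can be taken in \<open>C\<close>.\<close>

lemma two_acyclic_restrict:
  assumes C: "squig_upset S onto into C"
  shows "two_acyclic_factorization_system C (Restr arr C) (Restr onto C) (Restr into C)"
proof -
  have CS: "C \<subseteq> S" using C by (simp add: squig_upset_def)
  have onto: "(x, y) \<in> onto"
    if "x \<in> C" "y \<in> C" "\<forall>z\<in>C. (y, z) \<in> arr \<longrightarrow> (x, z) \<in> arr" for x y
  proof -
    have "(x, z) \<in> arr" if "(y, z) \<in> arr" for z
    proof -
      obtain w where w: "w \<in> C" "(y, w) \<in> onto" "(w, z) \<in> into"
        using factor_through_upset_source[OF C \<open>(y, z) \<in> arr\<close> \<open>y \<in> C\<close>] .
      then have "(y, w) \<in> arr" using onto_iff arr_refl by blast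
      then have "(x, w) \<in> arr" using w \<open>\<forall>z\<in>C. (y, z) \<in> arr \<longrightarrow> (x, z) \<in> arr\<close> by blast
      then show ?thesis using w into_iff by blast
    qed
    then show ?thesis using that CS onto_iff by blast
  qed
  have into: "(x, y) \<in> into"
    if "x \<in> C" "y \<in> C" "\<forall>z\<in>C. (z, x) \<in> arr \<longrightarrow> (z, y) \<in> arr" for x y
  proof -
    have "(z, y) \<in> arr" if "(z, x) \<in> arr" for z
    proof -
      obtain w where w: "w \<in> C" "(z, w) \<in> onto" "(w, x) \<in> into"
        using factor_through_upset_target[OF C \<open>(z, x) \<in> arr\<close> \<open>x \<in> C\<close>] .
      then have "(w, x) \<in> arr" using into_iff arr_refl by blast
      then have "(w, y) \<in> arr" using w \<open>\<forall>z\<in>C. (z, x) \<in> arr \<longrightarrow> (z, y) \<in> arr\<close> by blast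
      then show ?thesis using w onto_iff by blast
    qed
    then show ?thesis using that CS into_iff by blast
  qed
  have fact1: "Fact C (Restr arr C) = (Restr onto C, Restr into C)"
    using onto into by (auto simp: Fact_def dest: onto_iff[THEN iffD1] into_iff[THEN iffD1])
  have mult: "Mult C (Restr onto C) (Restr into C) = Restr arr C"
  proof (intro equalityI subrelI)
    fix x z assume "(x, z) \<in> Restr arr C"
    then have "(x, z) \<in> arr" "x \<in> C" "z \<in> C" by auto
    then show "(x, z) \<in> Mult C (Restr onto C) (Restr into C)"
      by (elim factor_through_upset_source[OF C]) (auto simp: Mult_def)
  qed (auto simp: Mult_def arr_iff)
  show ?thesis
    unfolding two_acyclic_factorization_system_def factorization_system_def
      order_condition_def brick_condition_def
    using CS arr_refl fact1 mult onto_antisym into_antisym brick by (auto simp: refl_on_def)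
qed

lemma fst_onto_closed:
  assumes "p \<in> max_orth_pairs S arr" "x \<in> fst p" "(x, y) \<in> onto"
  shows "y \<in> fst p"
  using assms onto_iff unfolding mem_fst_iff[OF assms(1)] by blast

lemma snd_into_closed:
  assumes "p \<in> max_orth_pairs S arr" "y \<in> snd p" "(x, y) \<in> into"
  shows "x \<in> snd p"
  using assms into_iff unfolding mem_snd_iff[OF assms(1)] by blast

lemma fst_restrict_pair: "fst (restrict_pair C p) = fst p \<inter> C"
  and snd_restrict_pair: "snd (restrict_pair C p) = snd p \<inter> C"
  by (simp_all add: restrict_pair_def split_beta)

text \<open>If some \<open>x\<close> in \<open>fst p\<close> has an arrow to \<open>y\<close> in
  \<open>C\<close>, the arrow factors through an object of \<open>C\<close>, which stays in
  \<open>fst p\<close> by closure under \<open>onto\<close>. So orthogonality to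
  \<open>fst p \<inter> C\<close> already gives orthogonality to \<open>fst p\<close>; the other
  side is dual, with closure under \<open>into\<close>.\<close>

lemma restrict_pair_mem:
  assumes C: "squig_upset S onto into C" and p: "p \<in> max_orth_pairs S arr"
  shows "restrict_pair C p \<in> max_orth_pairs C (Restr arr C)"
proof -
  have CS: "C \<subseteq> S" using C by (simp add: squig_upset_def)
  have "y \<in> snd p" if y: "y \<in> C" "\<forall>x\<in>fst p \<inter> C. (x, y) \<notin> arr" for y
  proof (rule ccontr)
    assume "y \<notin> snd p"
    then obtain x where "x \<in> fst p" "(x, y) \<in> arr" using mem_snd_iff[OF p] y CS by blast
    then show False
      using factor_through_upset_target[OF C _ y(1)] fst_onto_closed[OF p] y arr_iff into_iff
        onto_refl by (metis IntI)
  qed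
  moreover have "x \<in> fst p" if x: "x \<in> C" "\<forall>y\<in>snd p \<inter> C. (x, y) \<notin> arr" for x
  proof (rule ccontr)
    assume "x \<notin> fst p"
    then obtain y where "y \<in> snd p" "(x, y) \<in> arr" using mem_fst_iff[OF p] x CS by blast
    then show False
      using factor_through_upset_source[OF C _ x(1)] snd_into_closed[OF p] x arr_iff onto_iff
        into_refl by (metis IntI)
  qed
  moreover have "(x, y) \<notin> arr" if "x \<in> fst p" "y \<in> snd p" for x y
    using that mem_fst_iff[OF p] by blast
  ultimately show ?thesis
    unfolding max_orth_pairs_iff fst_restrict_pair snd_restrict_pair
    by (auto simp: right_orth_def left_orth_def)
qed

text \<open>Meets intersect first components and joins intersect second components. Both commute
  with intersecting by \<open>C\<close>, and one component determines the pair.\<close>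

lemma surj_lattice_hom_restrict_pair:
  assumes C: "squig_upset S onto into C"
  shows "surj_lattice_hom (Pairs S arr) (Pairs C (Restr arr C)) (restrict_pair C)"
proof -
  note mem = restrict_pair_mem[OF C]
  have meet: "restrict_pair C (p \<sqinter>\<^bsub>Pairs S arr\<^esub> q) =
      restrict_pair C p \<sqinter>\<^bsub>Pairs C (Restr arr C)\<^esub> restrict_pair C q"
    if "p \<in> max_orth_pairs S arr" "q \<in> max_orth_pairs S arr" for p q
    using that
    by (intro max_orth_pairs_eqI[of _ C "Restr arr C"])
      (auto intro!: mem meet_Pairs_mem simp: fst_meet_Pairs fst_restrict_pair mem)
  have join: "restrict_pair C (p \<squnion>\<^bsub>Pairs S arr\<^esub> q) =
      restrict_pair C p \<squnion>\<^bsub>Pairs C (Restr arr C)\<^esub> restrict_pair C q"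
    if "p \<in> max_orth_pairs S arr" "q \<in> max_orth_pairs S arr" for p q
    using that
    by (intro max_orth_pairs_eqI[of _ C "Restr arr C"])
      (auto intro!: mem join_Pairs_mem simp: snd_join_Pairs snd_restrict_pair mem)
  have surj: "q \<in> restrict_pair C ` max_orth_pairs S arr"
    if q: "q \<in> max_orth_pairs C (Restr arr C)" for q
  proof -
    have CS: "C \<subseteq> S" using C by (simp add: squig_upset_def)
    \<comment> \<open>The preimage of \<open>q\<close> is the closure of \<open>fst q\<close> in
      \<open>S\<close>; cutting its second component down to \<open>C\<close> gives
      \<open>snd q\<close>.\<close>
    define p where "p = (left_orth S arr (right_orth S arr (fst q)), right_orth S arr (fst q))"
    have p: "p \<in> max_orth_pairs S arr"
      unfolding p_def using max_orth_pairs_subset[OF q] CS by (intro left_orth_closure_mem) auto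
    have "snd (restrict_pair C p) = snd q"
      using mem_snd_iff[OF q] max_orth_pairs_subset[OF q] CS
      by (auto simp: p_def snd_restrict_pair right_orth_def)
    then have "restrict_pair C p = q"
      using max_orth_pairs_eqI[OF mem[OF p] q] by blast
    with p show ?thesis by blast
  qed
  show ?thesis
    unfolding surj_lattice_hom_def lattice_hom_def join_pres_def meet_pres_def
    using lattice_Pairs meet join mem surj by auto
qed

subsection \<open>Irreducible pairs\<close>

text \<open>For \<open>x\<close> in \<open>S\<close>, the set \<open>T(x)\<close> is the closure of
  \<open>{x}\<close>, so this is the least pair having \<open>x\<close> in its first
  component.\<close>

definition jpair :: "'a \<Rightarrow> 'a set \<times> 'a set" where
  "jpair x = (T_set S onto x, right_orth S arr {x})"

text \<open>Dually, for \<open>x\<close> in \<open>S\<close> this is the greatest pair having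
  \<open>x\<close> in its second component.\<close>

definition mpair :: "'a \<Rightarrow> 'a set \<times> 'a set" where
  "mpair x = (left_orth S arr {x}, F_set S into x)"

lemma jpair_mem: "x \<in> S \<Longrightarrow> jpair x \<in> max_orth_pairs S arr"
  by (auto simp: jpair_def max_orth_pairs_iff right_orth_def left_orth_def T_set_def onto_iff
      dest: arr_subset arr_refl)

lemma mpair_mem: "x \<in> S \<Longrightarrow> mpair x \<in> max_orth_pairs S arr"
  by (auto simp: mpair_def max_orth_pairs_iff right_orth_def left_orth_def F_set_def into_iff
      dest: arr_subset arr_refl)

lemma jpair_le_iff:
  assumes "p \<in> max_orth_pairs S arr" "x \<in> S"
  shows "fst (jpair x) \<subseteq> fst p \<longleftrightarrow> x \<in> fst p"
  using assms fst_onto_closed[OF assms(1)] onto_refl by (auto simp: jpair_def T_set_def)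

text \<open>Let \<open>y\<close> in \<open>T(x)\<close> have an arrow to \<open>x\<close>, with
  middle object \<open>w\<close>. Then \<open>x\<close> reaches \<open>w\<close> by
  \<open>onto\<close> and \<open>w\<close> reaches \<open>x\<close> by \<open>into\<close>, so
  \<open>w = x\<close> by the brick condition and \<open>y = x\<close> by antisymmetry of
  \<open>onto\<close>. Hence only \<open>x\<close> is lost from \<open>T(x)\<close> in the
  meet.\<close>

lemma fst_jpair_meet_mpair:
  assumes x: "x \<in> S"
  shows "fst (jpair x \<sqinter>\<^bsub>Pairs S arr\<^esub> mpair x) = T_set S onto x - {x}"
proof -
  have "y = x" if "(x, y) \<in> onto" "(y, x) \<in> arr" for y
    using that arr_iff onto_trans onto_antisym brick by metis
  then show ?thesis
    unfolding fst_meet_Pairs[OF jpair_mem[OF x] mpair_mem[OF x]]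
    using x arr_refl by (auto simp: jpair_def mpair_def left_orth_def T_set_def)
qed

lemma snd_jpair_join_mpair:
  assumes x: "x \<in> S"
  shows "snd (jpair x \<squnion>\<^bsub>Pairs S arr\<^esub> mpair x) = F_set S into x - {x}"
proof -
  have "y = x" if "(y, x) \<in> into" "(x, y) \<in> arr" for y
    using that arr_iff into_trans into_antisym brick by metis
  then show ?thesis
    unfolding snd_join_Pairs[OF jpair_mem[OF x] mpair_mem[OF x]]
    using x arr_refl by (auto simp: jpair_def mpair_def right_orth_def F_set_def)
qed

end

section \<open>Congruences\<close>

locale two_acyclic_congruence = two_acyclic +
  fixes \<Theta> :: "('a set \<times> 'a set) rel"
  assumes congruence: "lattice_congruence (Pairs S arr) \<Theta>"
begin

abbreviation L where "L \<equiv> Pairs S arr"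

lemma cong_mem: "(p, q) \<in> \<Theta> \<Longrightarrow> p \<in> max_orth_pairs S arr \<and> q \<in> max_orth_pairs S arr"
  and cong_refl: "p \<in> max_orth_pairs S arr \<Longrightarrow> (p, p) \<in> \<Theta>"
  and cong_sym: "(p, q) \<in> \<Theta> \<Longrightarrow> (q, p) \<in> \<Theta>"
  and cong_trans: "(p, q) \<in> \<Theta> \<Longrightarrow> (q, r) \<in> \<Theta> \<Longrightarrow> (p, r) \<in> \<Theta>"
  and cong_meet: "(p, p') \<in> \<Theta> \<Longrightarrow> (q, q') \<in> \<Theta> \<Longrightarrow> (p \<sqinter>\<^bsub>L\<^esub> q, p' \<sqinter>\<^bsub>L\<^esub> q') \<in> \<Theta>"
  and cong_join: "(p, p') \<in> \<Theta> \<Longrightarrow> (q, q') \<in> \<Theta> \<Longrightarrow> (p \<squnion>\<^bsub>L\<^esub> q, p' \<squnion>\<^bsub>L\<^esub> q') \<in> \<Theta>"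
  using congruence unfolding lattice_congruence_def equiv_def refl_on_def carrier_Pairs
  by (blast dest: symD transD)+

text \<open>Joining both sides of the given congruence with \<open>q\<close> leaves \<open>q\<close>
  and \<open>r\<close>.\<close>

lemma cong_convex:
  assumes "(p, r) \<in> \<Theta>" "q \<in> max_orth_pairs S arr" "fst p \<subseteq> fst q" "fst q \<subseteq> fst r"
  shows "(q, r) \<in> \<Theta>"
  using cong_join[OF assms(1) cong_refl[OF assms(2)]] assms cong_mem[OF assms(1)]
  by (simp add: join_Pairs_absorb1 join_Pairs_absorb2)

section \<open>The uncontracted elements form an upset\<close>

definition uncontracted :: "'a set" where
  "uncontracted = {x \<in> S. (jpair x \<sqinter>\<^bsub>L\<^esub> mpair x, jpair x) \<notin> \<Theta>}"

text \<open>Opposite sides of the square spanned by \<open>p\<close> and \<open>q\<close> are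
  contracted together: join the given congruence with \<open>q\<close>. Applied to
  \<open>jpair x\<close> and \<open>mpair x\<close>, this moves a contraction from the edge below
  \<open>jpair x\<close> to the edge above \<open>mpair x\<close>.\<close>

lemma meet_cong_imp_join_cong:
  assumes "(p \<sqinter>\<^bsub>L\<^esub> q, p) \<in> \<Theta>" and p: "p \<in> max_orth_pairs S arr" and q: "q \<in> max_orth_pairs S arr"
  shows "(q, p \<squnion>\<^bsub>L\<^esub> q) \<in> \<Theta>"
  using cong_join[OF assms(1) cong_refl[OF q]] p q
  by (simp add: join_Pairs_absorb1[OF meet_Pairs_mem[OF p q] q] fst_meet_Pairs)

lemma join_cong_imp_meet_cong:
  assumes "(q, p \<squnion>\<^bsub>L\<^esub> q) \<in> \<Theta>" and p: "p \<in> max_orth_pairs S arr" and q: "q \<in> max_orth_pairs S arr"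
  shows "(p \<sqinter>\<^bsub>L\<^esub> q, p) \<in> \<Theta>"
proof -
  have "fst p \<subseteq> fst (p \<squnion>\<^bsub>L\<^esub> q)"
    using p q by (simp add: fst_subset_iff[OF p join_Pairs_mem[OF p q]] snd_join_Pairs)
  then show ?thesis
    using cong_meet[OF cong_refl[OF p] assms(1)] p q
    by (simp add: meet_Pairs_absorb1[OF p join_Pairs_mem[OF p q]])
qed

text \<open>Maximality forbids arrows from \<open>y\<close> to elements of \<open>F(x)\<close> other
  than \<open>x\<close>, so \<open>jpair y\<close> lies below the upper cover of
  \<open>mpair x\<close>. Meeting that contracted edge with \<open>jpair y\<close> identifies
  \<open>jpair y\<close> with an element whose first component misses \<open>y\<close>, hence one
  below its lower cover; convexity finishes.\<close>

lemma contracted_if_squig_maximal: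
  assumes max: "maximal_in into (T_set S onto y) x" and "x \<in> S" "y \<in> S"
    and contr: "(jpair x \<sqinter>\<^bsub>L\<^esub> mpair x, jpair x) \<in> \<Theta>"
  shows "(jpair y \<sqinter>\<^bsub>L\<^esub> mpair y, jpair y) \<in> \<Theta>"
proof (cases "x = y")
  case False
  note mems = jpair_mem[OF \<open>x \<in> S\<close>] mpair_mem[OF \<open>x \<in> S\<close>] jpair_mem[OF \<open>y \<in> S\<close>] mpair_mem[OF \<open>y \<in> S\<close>]
  let ?u = "jpair x \<squnion>\<^bsub>L\<^esub> mpair x"
  have u: "?u \<in> max_orth_pairs S arr" by (intro join_Pairs_mem mems)
  have yx: "(y, x) \<in> onto" using max by (auto simp: maximal_in_def T_set_def)
  have "(y, z) \<notin> arr" if "(z, x) \<in> into" "z \<noteq> x" for z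
  proof
    assume "(y, z) \<in> arr"
    then obtain w where w: "(y, w) \<in> onto" "(w, z) \<in> into" using arr_iff by blast
    then have "(w, x) \<in> into" using that into_trans by blast
    then have "w = x" using max w onto_iff unfolding maximal_in_def T_set_def by blast
    then show False using that w into_antisym by blast
  qed
  then have "snd ?u \<subseteq> snd (jpair y)"
    unfolding snd_jpair_join_mpair[OF \<open>x \<in> S\<close>] by (auto simp: F_set_def jpair_def right_orth_def)
  then have le: "fst (jpair y) \<subseteq> fst ?u" using fst_subset_iff[OF mems(3) u] by blast
  have "(mpair x, ?u) \<in> \<Theta>" using contr meet_cong_imp_join_cong mems by blast
  from cong_meet[OF cong_refl[OF mems(3)] this]
  have "(jpair y \<sqinter>\<^bsub>L\<^esub> mpair x, jpair y) \<in> \<Theta>"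
    using le by (simp add: meet_Pairs_absorb1[OF mems(3) u])
  moreover have "fst (jpair y \<sqinter>\<^bsub>L\<^esub> mpair x) \<subseteq> fst (jpair y \<sqinter>\<^bsub>L\<^esub> mpair y)"
  proof -
    have "y \<notin> fst (mpair x)"
      using yx arr_iff into_refl[OF \<open>x \<in> S\<close>] by (auto simp: mpair_def left_orth_def)
    then show ?thesis
      using fst_jpair_meet_mpair[OF \<open>y \<in> S\<close>] fst_meet_Pairs[OF mems(3,2)] by (auto simp: jpair_def)
  qed
  ultimately show ?thesis
    using cong_convex[OF _ meet_Pairs_mem[OF mems(3,4)]] by (simp add: fst_meet_Pairs mems)
qed (use contr in simp)

text \<open>The dual argument uses upper covers: minimality puts the lower cover of
  \<open>jpair x\<close> below \<open>mpair y\<close>, and joining the contracted edge with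
  \<open>mpair y\<close> contracts the edge above \<open>mpair y\<close>. The contraction is then
  carried back to the edge below \<open>jpair y\<close>.\<close>

lemma contracted_if_squig_minimal:
  assumes min: "minimal_in onto (F_set S into y) x" and "x \<in> S" "y \<in> S"
    and contr: "(jpair x \<sqinter>\<^bsub>L\<^esub> mpair x, jpair x) \<in> \<Theta>"
  shows "(jpair y \<sqinter>\<^bsub>L\<^esub> mpair y, jpair y) \<in> \<Theta>"
proof (cases "x = y")
  case False
  note mems = jpair_mem[OF \<open>x \<in> S\<close>] mpair_mem[OF \<open>x \<in> S\<close>] jpair_mem[OF \<open>y \<in> S\<close>] mpair_mem[OF \<open>y \<in> S\<close>]
  let ?l = "jpair x \<sqinter>\<^bsub>L\<^esub> mpair x"
  have l: "?l \<in> max_orth_pairs S arr" by (intro meet_Pairs_mem mems)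
  have xy: "(x, y) \<in> into" using min by (auto simp: minimal_in_def F_set_def)
  have "(z, y) \<notin> arr" if "(x, z) \<in> onto" "z \<noteq> x" for z
  proof
    assume "(z, y) \<in> arr"
    then obtain w where w: "(z, w) \<in> onto" "(w, y) \<in> into" using arr_iff by blast
    then have "(x, w) \<in> onto" using that onto_trans by blast
    then have "w = x" using min w into_iff unfolding minimal_in_def F_set_def by blast
    then show False using that w onto_antisym by blast
  qed
  then have le: "fst ?l \<subseteq> fst (mpair y)"
    unfolding fst_jpair_meet_mpair[OF \<open>x \<in> S\<close>] by (auto simp: T_set_def mpair_def left_orth_def)
  from cong_join[OF contr cong_refl[OF mems(4)]]
  have cong: "(mpair y, jpair x \<squnion>\<^bsub>L\<^esub> mpair y) \<in> \<Theta>"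
    using le by (simp add: join_Pairs_absorb1[OF l mems(4)])
  let ?v = "jpair y \<squnion>\<^bsub>L\<^esub> mpair y"
  have v: "?v \<in> max_orth_pairs S arr" "jpair x \<squnion>\<^bsub>L\<^esub> mpair y \<in> max_orth_pairs S arr"
    by (intro join_Pairs_mem mems)+
  have "y \<notin> snd (jpair x)"
    using xy arr_iff onto_refl[OF \<open>x \<in> S\<close>] by (auto simp: jpair_def right_orth_def)
  then have "snd (jpair x \<squnion>\<^bsub>L\<^esub> mpair y) \<subseteq> snd ?v"
    using snd_jpair_join_mpair[OF \<open>y \<in> S\<close>] snd_join_Pairs[OF mems(1,4)] by (auto simp: mpair_def)
  moreover have "snd ?v \<subseteq> snd (mpair y)"
    by (simp add: snd_join_Pairs mems)
  \<comment> \<open>The upper cover \<open>?v\<close> of \<open>mpair y\<close> lies between two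
    congruent elements.\<close>
  ultimately have "(?v, jpair x \<squnion>\<^bsub>L\<^esub> mpair y) \<in> \<Theta>"
    using cong_convex[OF cong v(1)] fst_subset_iff[OF v] fst_subset_iff[OF mems(4) v(1)] by blast
  then have "(mpair y, ?v) \<in> \<Theta>" using cong cong_sym cong_trans by blast
  then show ?thesis by (rule join_cong_imp_meet_cong[OF _ mems(3,4)])
qed (use contr in simp)

lemma squig_upset_uncontracted: "squig_upset S onto into uncontracted"
  using contracted_if_squig_maximal contracted_if_squig_minimal
  by (auto simp: squig_upset_def squig_def uncontracted_def)

section \<open>A congruence is determined by its uncontracted elements\<close>

lemma fst_uncontracted_subset_if_cong:
  assumes "(p, q) \<in> \<Theta>"
  shows "fst p \<inter> uncontracted \<subseteq> fst q"
proof (rule subsetI, rule ccontr)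
  fix x assume x: "x \<in> fst p \<inter> uncontracted" and nx: "x \<notin> fst q"
  have mem: "p \<in> max_orth_pairs S arr" "q \<in> max_orth_pairs S arr" using cong_mem assms by blast+
  have xS: "x \<in> S" using x by (simp add: uncontracted_def)
  note mems = jpair_mem[OF xS] mpair_mem[OF xS]
  \<comment> \<open>The left meet is \<open>jpair x\<close> because \<open>x\<close> lies in
    \<open>fst p\<close>; the right one misses \<open>x\<close>, so it is below the lower cover of
    \<open>jpair x\<close>. Convexity would contract that edge.\<close>
  have "(jpair x \<sqinter>\<^bsub>L\<^esub> p, jpair x \<sqinter>\<^bsub>L\<^esub> q) \<in> \<Theta>"
    using cong_meet[OF cong_refl[OF mems(1)] assms] .
  then have "(jpair x \<sqinter>\<^bsub>L\<^esub> q, jpair x) \<in> \<Theta>"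
    using x jpair_le_iff[OF mem(1) xS] meet_Pairs_absorb1[OF mems(1) mem(1)] cong_sym by auto
  moreover have "fst (jpair x \<sqinter>\<^bsub>L\<^esub> q) \<subseteq> fst (jpair x \<sqinter>\<^bsub>L\<^esub> mpair x)"
    using nx unfolding fst_jpair_meet_mpair[OF xS] fst_meet_Pairs[OF mems(1) mem(2)]
    by (auto simp: jpair_def)
  ultimately have "(jpair x \<sqinter>\<^bsub>L\<^esub> mpair x, jpair x) \<in> \<Theta>"
    using cong_convex[OF _ meet_Pairs_mem[OF mems]] by (simp add: fst_meet_Pairs mems)
  then show False using x by (simp add: uncontracted_def)
qed

text \<open>Climb from \<open>p\<close> to \<open>q\<close> by joining with one
  \<open>jpair x\<close> at a time. For \<open>x\<close> chosen \<open>onto\<close>-minimal in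
  \<open>fst q - fst p\<close>, the lower cover of \<open>jpair x\<close> is already below
  \<open>p\<close>, and \<open>x\<close> is contracted by hypothesis; joining its edge with
  \<open>p\<close> makes \<open>p\<close> congruent to the next element of the chain.\<close>

lemma cong_if_fst_uncontracted_subset:
  assumes p: "p \<in> max_orth_pairs S arr" and q: "q \<in> max_orth_pairs S arr"
    and "fst p \<subseteq> fst q" "fst q \<inter> uncontracted \<subseteq> fst p"
  shows "(p, q) \<in> \<Theta>"
  using p assms(3,4)
proof (induction "card (fst q - fst p)" arbitrary: p rule: less_induct)
  case less
  have fin: "finite (fst q)"
    using finite_S max_orth_pairs_subset(1)[OF q] by (rule rev_finite_subset)
  show ?case
  proof (cases "fst q \<subseteq> fst p")
    case True
    then have "p = q" using less.prems q max_orth_pairs_eqI by blast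
    then show ?thesis using cong_refl q by blast
  next
    case False
    then obtain y where y: "y \<in> fst q - fst p" by blast
    then have "y \<in> S" using max_orth_pairs_subset(1)[OF q] by blast
    then obtain x where x: "minimal_in onto (fst q - fst p) x"
      using y fin
      by (elim ex_minimal_in[of "fst q - fst p" y onto, rotated 2, OF onto_refl])
        (auto intro: transI antisymI onto_trans onto_antisym)
    then have xqp: "x \<in> fst q" "x \<notin> fst p" by (auto simp: minimal_in_def)
    then have xS: "x \<in> S" using max_orth_pairs_subset(1)[OF q] by blast
    note mems = jpair_mem[OF xS] mpair_mem[OF xS]
    let ?l = "jpair x \<sqinter>\<^bsub>L\<^esub> mpair x" and ?r = "p \<squnion>\<^bsub>L\<^esub> jpair x"
    have l: "?l \<in> max_orth_pairs S arr" by (intro meet_Pairs_mem mems)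
    have r: "?r \<in> max_orth_pairs S arr" by (intro join_Pairs_mem mems less.prems)
    have "fst ?l \<subseteq> fst p"
      using x fst_onto_closed[OF q xqp(1)] unfolding fst_jpair_meet_mpair[OF xS]
      by (auto simp: T_set_def minimal_in_def)
    moreover have "(?l, jpair x) \<in> \<Theta>"
      using xqp xS less.prems by (auto simp: uncontracted_def)
    ultimately have pr: "(p, ?r) \<in> \<Theta>"
      using cong_join[OF cong_refl[OF less.prems(1)]] join_Pairs_absorb2[OF l less.prems(1)] by metis
    have "snd ?r = snd p \<inter> snd (jpair x)"
      by (simp add: snd_join_Pairs less.prems mems)
    then have sub: "fst p \<subseteq> fst ?r" "fst (jpair x) \<subseteq> fst ?r" "fst ?r \<subseteq> fst q"
      using fst_subset_iff[OF less.prems(1) r] fst_subset_iff[OF mems(1) r] fst_subset_iff[OF r q]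
        fst_subset_iff[OF less.prems(1) q] fst_subset_iff[OF mems(1) q]
        less.prems jpair_le_iff[OF q xS] xqp by auto
    then have "x \<in> fst ?r" using jpair_le_iff[OF r xS] by blast
    then have "fst q - fst ?r \<subset> fst q - fst p" using xqp sub by blast
    then have "card (fst q - fst ?r) < card (fst q - fst p)"
      using fin by (intro psubset_card_mono) auto
    then have "(?r, q) \<in> \<Theta>" using less.hyps[OF _ r] sub less.prems by blast
    with pr show ?thesis by (rule cong_trans)
  qed
qed

lemma cong_iff_restrict_pair_eq:
  assumes p: "p \<in> max_orth_pairs S arr" and q: "q \<in> max_orth_pairs S arr"
  shows "(p, q) \<in> \<Theta> \<longleftrightarrow> restrict_pair uncontracted p = restrict_pair uncontracted q"
proof
  assume "(p, q) \<in> \<Theta>"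
  then have "fst (restrict_pair uncontracted p) = fst (restrict_pair uncontracted q)"
    using fst_uncontracted_subset_if_cong[of p q] fst_uncontracted_subset_if_cong[of q p] cong_sym
    by (auto simp: fst_restrict_pair)
  then show "restrict_pair uncontracted p = restrict_pair uncontracted q"
    using max_orth_pairs_eqI restrict_pair_mem[OF squig_upset_uncontracted] p q by blast
next
  assume "restrict_pair uncontracted p = restrict_pair uncontracted q"
  then have eq: "fst p \<inter> uncontracted = fst q \<inter> uncontracted" by (metis fst_restrict_pair)
  \<comment> \<open>The previous lemma needs comparable pairs; the meet lies below both and has the
    same uncontracted elements in its first component.\<close>
  let ?m = "p \<sqinter>\<^bsub>L\<^esub> q"
  have m: "?m \<in> max_orth_pairs S arr" "fst ?m = fst p \<inter> fst q"
    using p q by (simp_all add: meet_Pairs_mem fst_meet_Pairs)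
  then have "(?m, p) \<in> \<Theta>" "(?m, q) \<in> \<Theta>"
    using eq by (auto intro!: cong_if_fst_uncontracted_subset p q)
  then show "(p, q) \<in> \<Theta>" using cong_sym cong_trans by blast
qed

section \<open>Recovering the upset from the quotient\<close>

lemma quotient_arises_from_iff:
  assumes C: "squig_upset S onto into C"
  shows "quotient_arises_from L \<Theta> (Pairs C (Restr arr C)) (restrict_pair C) \<longleftrightarrow>
    (\<forall>p\<in>max_orth_pairs S arr. \<forall>q\<in>max_orth_pairs S arr.
      (p, q) \<in> \<Theta> \<longleftrightarrow> restrict_pair C p = restrict_pair C q)"
proof -
  let ?A = "max_orth_pairs S arr" and ?B = "max_orth_pairs C (Restr arr C)"
  \<comment> \<open>\<open>K\<close> is the kernel of restriction. By surjectivity its classes are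
    exactly the fibers, so the claim becomes equality of two partitions.\<close>
  define K where "K = {(p, q). p \<in> ?A \<and> q \<in> ?A \<and> restrict_pair C p = restrict_pair C q}"
  have surj: "surj_lattice_hom L (Pairs C (Restr arr C)) (restrict_pair C)"
    using C by (rule surj_lattice_hom_restrict_pair)
  then have img: "restrict_pair C ` ?A = ?B" by (simp add: surj_lattice_hom_def)
  have K: "equiv ?A K" by (auto simp: K_def equiv_def refl_on_def sym_def trans_def)
  have \<Theta>: "equiv ?A \<Theta>" using congruence by (simp add: lattice_congruence_def)
  have "{p \<in> ?A. restrict_pair C p = restrict_pair C q} = K `` {q}" if "q \<in> ?A" for q
    using that by (auto simp: K_def)
  then have "(\<lambda>q. {p \<in> ?A. restrict_pair C p = q}) ` ?B = (\<lambda>q. K `` {q}) ` ?A"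
    unfolding img[symmetric] image_image by (rule image_cong[OF refl])
  then have "(\<lambda>q. {p \<in> ?A. restrict_pair C p = q}) ` ?B = ?A // K"
    by (simp only: quotient_def UNION_singleton_eq_range)
  then have "quotient_arises_from L \<Theta> (Pairs C (Restr arr C)) (restrict_pair C) \<longleftrightarrow> ?A // \<Theta> = ?A // K"
    using surj by (simp only: quotient_arises_from_def carrier_Pairs simp_thms)
  also have "\<dots> \<longleftrightarrow> \<Theta> = K"
    using quotient_inject[OF \<Theta> K] by metis
  also have "\<dots> \<longleftrightarrow> (\<forall>p\<in>?A. \<forall>q\<in>?A. (p, q) \<in> \<Theta> \<longleftrightarrow> restrict_pair C p = restrict_pair C q)"
  proof
    assume R: "\<forall>p\<in>?A. \<forall>q\<in>?A. (p, q) \<in> \<Theta> \<longleftrightarrow> restrict_pair C p = restrict_pair C q"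
    show "\<Theta> = K"
    proof (intro equalityI subrelI)
      show "(p, q) \<in> K" if "(p, q) \<in> \<Theta>" for p q
        using that R cong_mem[OF that] unfolding K_def by blast
      show "(p, q) \<in> \<Theta>" if "(p, q) \<in> K" for p q
        using that R unfolding K_def by blast
    qed
  qed (simp add: K_def)
  finally show ?thesis .
qed

text \<open>The first components of \<open>jpair x\<close> and its lower cover differ exactly in
  \<open>x\<close>, so restriction to \<open>C\<close> identifies the two iff \<open>x\<close> is
  outside \<open>C\<close>. The congruence thus decides membership in \<open>C\<close>.\<close>

lemma upset_eq_uncontracted:
  assumes C: "squig_upset S onto into C"
    and "quotient_arises_from L \<Theta> (Pairs C (Restr arr C)) (restrict_pair C)"
  shows "C = uncontracted"
proof -
  have "x \<in> C \<longleftrightarrow> (jpair x \<sqinter>\<^bsub>L\<^esub> mpair x, jpair x) \<notin> \<Theta>" if xS: "x \<in> S" for x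
  proof -
    note mems = jpair_mem[OF xS] mpair_mem[OF xS]
    let ?l = "jpair x \<sqinter>\<^bsub>L\<^esub> mpair x"
    have l: "?l \<in> max_orth_pairs S arr" by (intro meet_Pairs_mem mems)
    have "(?l, jpair x) \<in> \<Theta> \<longleftrightarrow> restrict_pair C ?l = restrict_pair C (jpair x)"
      using assms quotient_arises_from_iff l mems by blast
    also have "\<dots> \<longleftrightarrow> fst (restrict_pair C ?l) = fst (restrict_pair C (jpair x))"
      using max_orth_pairs_eqI[OF restrict_pair_mem[OF C l] restrict_pair_mem[OF C mems(1)]] by metis
    also have "\<dots> \<longleftrightarrow> x \<notin> C"
      using onto_refl[OF xS] xS unfolding fst_restrict_pair fst_jpair_meet_mpair[OF xS]
      by (auto simp: jpair_def T_set_def)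
    finally show ?thesis by blast
  qed
  moreover have "C \<subseteq> S" using C by (simp add: squig_upset_def)
  ultimately show ?thesis unfolding uncontracted_def by blast
qed

end

theorem theorem1p5:
  fixes S :: "'a set" and arr onto into :: "'a rel"
  assumes "finite S"
    and "two_acyclic_factorization_system S arr onto into"
  shows "(\<forall>C. squig_upset S onto into C \<longrightarrow>
            two_acyclic_factorization_system C (Restr arr C) (Restr onto C) (Restr into C) \<and>
            surj_lattice_hom (Pairs S arr) (Pairs C (Restr arr C)) (restrict_pair C)) \<and>
         (\<forall>\<Theta>. lattice_congruence (Pairs S arr) \<Theta> \<longrightarrow>
            (\<exists>!C. squig_upset S onto into C \<and>
              quotient_arises_from (Pairs S arr) \<Theta> (Pairs C (Restr arr C)) (restrict_pair C)))"
proof -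
  interpret two_acyclic S arr onto into by unfold_locales (fact assms)+
  have "\<exists>!C. squig_upset S onto into C \<and>
      quotient_arises_from (Pairs S arr) \<Theta> (Pairs C (Restr arr C)) (restrict_pair C)"
    if "lattice_congruence (Pairs S arr) \<Theta>" for \<Theta>
  proof -
    interpret two_acyclic_congruence S arr onto into \<Theta> by unfold_locales (fact that)
    show ?thesis
      using squig_upset_uncontracted quotient_arises_from_iff[OF squig_upset_uncontracted]
        cong_iff_restrict_pair_eq upset_eq_uncontracted
      by (intro ex1I[of _ uncontracted]) blast+
  qed
  then show ?thesis
    using two_acyclic_restrict surj_lattice_hom_restrict_pair by blast
qed

end
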